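(* For each integer $n\ge 1$ let $A'_{n+2}$ be the set of all primes $p$ with $F_{n+1}<p\le F_{n+2}$. Then: (i) for every $n\ge 1$ and every $p\in A'_{n+2}$, the binomial coefficient $\binom{F_{n+2}}{F_n}$ is divisible by $p$; and (ii) the union $A'_3\cup A'_4\cup A'_5\cup\cdots=\bigcup_{n\ge 1}A'_{n+2}$ is the set of all prime numbers, the primes being obtained in increasing order as $n$ increases (every element of $A'_{n+2}$ is smaller than every element of $A'_{m+2}$ whenever $1\le n<m$).
   Context: $F_n$ is the Fibonacci sequence with $F_1=F_2=1$, $F_{n+2}=F_{n+1}+F_n$. *)

theory Defs
  imports "HOL-Number_Theory.Fib" "HOL-Computational_Algebra.Primes"
begin

(* fib_primes n is the set A'_{n+2}: the argument is the n of the bounds F_{n+1} and F_{n+2},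
   not the subscript of A'. The library's fib satisfies fib 1 = fib 2 = 1. *)
definition fib_primes :: "nat \<Rightarrow> nat set" where
  "fib_primes n = {p. prime p \<and> fib (n + 1) < p \<and> p \<le> fib (n + 2)}"

end

theory Submission
  imports Defs
begin

text \<open>Put k = F_n and l = F_{n+1}, so F_{n+2} = k + l. A prime p in (l, k + l] exceeds both k
  and l, and \<open>prime_dvd_binomial\<close> applies. The intervals (F_{n+1}, F_{n+2}] with n
  \<ge> 1 follow one another without gaps from F_2 = 1, and F is unbounded by
  \<open>less_fib_add_2\<close>, so they catch every prime, in increasing order.\<close>

lemma less_fib_add_2: "n < fib (n + 2)"
proof (induction n)
  case (Suc n)
  have "fib (Suc n) > 0"
    by (simp add: fib_neq_0_nat)
  with Suc show ?case
    by simp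
qed simp

text \<open>The prime p occurs in (k + l)! but in neither k! nor l!, so it survives in the
  quotient.\<close>

lemma prime_dvd_binomial:
  fixes p :: nat
  assumes "prime p" "k < p" "l < p" "p \<le> k + l"
  shows "p dvd (k + l choose k)"
proof -
  have "fact k * fact l * (k + l choose k) = (fact (k + l) :: nat)"
    using binomial_fact_lemma[of k "k + l"] by simp
  moreover have "p dvd fact (k + l)"
    using assms by (simp add: prime_dvd_fact_iff)
  ultimately have "p dvd fact k * fact l * (k + l choose k)"
    by metis
  with assms show ?thesis
    by (simp add: prime_dvd_mult_iff prime_dvd_fact_iff)
qed

theorem theorem5:
  shows "(\<forall>n::nat. n \<ge> 1 \<longrightarrow> (\<forall>p \<in> fib_primes n. p dvd (fib (n + 2) choose fib n)))
    \<and> (\<Union>n \<in> {1..}. fib_primes n) = {p::nat. prime p}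
    \<and> (\<forall>n m::nat. 1 \<le> n \<and> n < m \<longrightarrow>
          (\<forall>p \<in> fib_primes n. \<forall>q \<in> fib_primes m. p < q))"
proof (intro conjI allI impI ballI)
  fix n p :: nat
  assume p: "p \<in> fib_primes n"
  \<comment> \<open>Membership only bounds \<open>fib (n + 1)\<close> below p; monotonicity extends
    this to \<open>fib n\<close>.\<close>
  have "fib n \<le> fib (n + 1)"
    by (rule fib_mono) simp
  with p have "p dvd (fib n + fib (n + 1) choose fib n)"
    by (intro prime_dvd_binomial) (auto simp: fib_primes_def)
  then show "p dvd (fib (n + 2) choose fib n)"
    by (simp add: add.commute)
next
  have "\<exists>n\<ge>1. p \<in> fib_primes n" if "prime p" for p
  proof -
    define n where "n = (LEAST n. p \<le> fib (n + 2))"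
    have le: "p \<le> fib (n + 2)"
      unfolding n_def by (rule LeastI) (rule less_imp_le[OF less_fib_add_2])
    \<comment> \<open>For n = 0 the bound would read p \<le> F_2 = 1.\<close>
    with prime_gt_1_nat[OF that] have "n \<noteq> 0"
      by (intro notI) simp
    then obtain m where m: "n = Suc m"
      using not0_implies_Suc by blast
    \<comment> \<open>Minimality of n rules out m = n - 1, whose upper bound
      \<open>fib (m + 2)\<close> is \<open>fib (n + 1)\<close>.\<close>
    have "fib (n + 1) < p"
      using not_less_Least[of m "\<lambda>n. p \<le> fib (n + 2)"] m unfolding n_def[symmetric] by simp
    with that le m show ?thesis
      by (auto simp: fib_primes_def)
  qed
  then show "(\<Union>n \<in> {1..}. fib_primes n) = {p. prime p}"
    by (auto simp: fib_primes_def)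
next
  fix n m p q :: nat
  assume "1 \<le> n \<and> n < m" and "p \<in> fib_primes n" "q \<in> fib_primes m"
  \<comment> \<open>This separates the intervals: p is at most the left side, q exceeds the right
    side.\<close>
  moreover from this have "fib (n + 2) \<le> fib (m + 1)"
    by (intro fib_mono) simp
  ultimately show "p < q"
    by (simp add: fib_primes_def)
qed

end
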